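(* Define the weak law of the excluded middle \[ \mathsf{WLEM}:=\Pi_{X:\mathcal{U}}\Sigma_{b:\mathsf{bool}}\,\mathsf{if}_{\mathcal{U}}(b;\neg X;\neg\neg X). \] There is a term of type $\mathsf{WLEM}\to\mathsf{void}$.
   Context: We work in parametric cubical type theory: Martin-Löf type theory with $\Sigma$-, $\Pi$-types, an empty type $\mathsf{void}$, a unit type, a boolean type $\mathsf{bool}$ (elements $\mathsf{true},\mathsf{false}$, eliminator $\mathsf{if}$, assumed to satisfy the exact $\eta$-rule $b=\mathsf{if}(b;\mathsf{true};\mathsf{false})$), and a univalent universe $\mathcal{U}$ of Kan types, extended by structural path dimensions with path types and Kan operations, so that paths behave like homotopy-type-theoretic identity types, and by substructural bridge dimensions (weakening and exchange, no contraction) with bridge types $\mathsf{Bridge}_{\mathbf{x}.A}(M_{\mathbf{0}},M_{\mathbf{1}})$, Gel-types $\mathsf{Gel}_{\mathbf{r}}(A,B,a.b.R)$ (equal to $A$ at $\mathbf{0}$, $B$ at $\mathbf{1}$, with $\mathsf{gel}$/$\mathsf{ungel}$ and $\beta,\eta$) and an $\mathsf{extent}$ operator; $\mathcal{U}$ is closed under these. $\neg X:=X\to\mathsf{void}$. *)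

theory Defs
  imports Main
begin

section \<open>Raw syntax\<close>

text \<open>
  Terms, types and dimension expressions share one de Bruijn syntax, so one substitution function
  serves term variables, path dimension variables and bridge dimension variables alike; the
  judgements below keep the sorts apart.  \<open>I0, I1\<close> are the endpoints of the path interval and
  \<open>B0, B1\<close> those of the bridge interval (bold in the literature).  How many variables each
  argument of a constructor binds can be read off from \<open>ren\<close>.  The tubes of \<open>HCom\<close> are triples
  \<open>(a, b, N)\<close>, standing for \<open>a = b \<hookrightarrow> i.N\<close>: the constraint \<open>a = b\<close> binds nothing and \<open>N\<close> binds
  the path dimension \<open>i\<close>.
\<close>

datatype tm =
    Var nat
  | I0 | I1
  | B0 | B1
  | Univ
  | Void | Abort tm
  | Unit | Star
  | Bool | TT | FF | IfE tm tm tm tm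
  | Pi tm tm | Lam tm | App tm tm
  | Sig tm tm | Tup tm tm | Fst tm | Snd tm
  | Path tm tm tm | PLam tm | PApp tm tm
  | Coe tm tm tm tm
  | HCom tm tm tm tm "(tm \<times> tm \<times> tm) list"
  | V tm tm tm tm | VIn tm tm tm | VProj tm tm tm
  | Bridge tm tm tm | BLam tm | BApp tm tm
  | Gel tm tm tm tm | GelI tm tm tm tm | Ungel tm
  | Extent tm tm tm tm tm

fun upr :: "(nat \<Rightarrow> nat) \<Rightarrow> nat \<Rightarrow> nat" where
  "upr \<rho> 0 = 0"
| "upr \<rho> (Suc n) = Suc (\<rho> n)"

fun ren :: "(nat \<Rightarrow> nat) \<Rightarrow> tm \<Rightarrow> tm" where
  "ren \<rho> (Var n) = Var (\<rho> n)"
| "ren \<rho> I0 = I0"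
| "ren \<rho> I1 = I1"
| "ren \<rho> B0 = B0"
| "ren \<rho> B1 = B1"
| "ren \<rho> Univ = Univ"
| "ren \<rho> Void = Void"
| "ren \<rho> (Abort M) = Abort (ren \<rho> M)"
| "ren \<rho> Unit = Unit"
| "ren \<rho> Star = Star"
| "ren \<rho> Bool = Bool"
| "ren \<rho> TT = TT"
| "ren \<rho> FF = FF"
| "ren \<rho> (IfE C M T F) = IfE (ren (upr \<rho>) C) (ren \<rho> M) (ren \<rho> T) (ren \<rho> F)"
| "ren \<rho> (Pi A B) = Pi (ren \<rho> A) (ren (upr \<rho>) B)"
| "ren \<rho> (Lam M) = Lam (ren (upr \<rho>) M)"
| "ren \<rho> (App M N) = App (ren \<rho> M) (ren \<rho> N)"
| "ren \<rho> (Sig A B) = Sig (ren \<rho> A) (ren (upr \<rho>) B)"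
| "ren \<rho> (Tup M N) = Tup (ren \<rho> M) (ren \<rho> N)"
| "ren \<rho> (Fst M) = Fst (ren \<rho> M)"
| "ren \<rho> (Snd M) = Snd (ren \<rho> M)"
| "ren \<rho> (Path A M N) = Path (ren (upr \<rho>) A) (ren \<rho> M) (ren \<rho> N)"
| "ren \<rho> (PLam M) = PLam (ren (upr \<rho>) M)"
| "ren \<rho> (PApp M r) = PApp (ren \<rho> M) (ren \<rho> r)"
| "ren \<rho> (Coe A r s M) = Coe (ren (upr \<rho>) A) (ren \<rho> r) (ren \<rho> s) (ren \<rho> M)"
| "ren \<rho> (HCom A r s M T) = HCom (ren \<rho> A) (ren \<rho> r) (ren \<rho> s) (ren \<rho> M)
     (map (\<lambda>(a, b, N). (ren \<rho> a, ren \<rho> b, ren (upr \<rho>) N)) T)"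
| "ren \<rho> (V r A B E) = V (ren \<rho> r) (ren \<rho> A) (ren \<rho> B) (ren \<rho> E)"
| "ren \<rho> (VIn r M N) = VIn (ren \<rho> r) (ren \<rho> M) (ren \<rho> N)"
| "ren \<rho> (VProj r M E) = VProj (ren \<rho> r) (ren \<rho> M) (ren \<rho> E)"
| "ren \<rho> (Bridge A M N) = Bridge (ren (upr \<rho>) A) (ren \<rho> M) (ren \<rho> N)"
| "ren \<rho> (BLam M) = BLam (ren (upr \<rho>) M)"
| "ren \<rho> (BApp M r) = BApp (ren \<rho> M) (ren \<rho> r)"
| "ren \<rho> (Gel r A B R) = Gel (ren \<rho> r) (ren \<rho> A) (ren \<rho> B) (ren (upr (upr \<rho>)) R)"
| "ren \<rho> (GelI r M N P) = GelI (ren \<rho> r) (ren \<rho> M) (ren \<rho> N) (ren \<rho> P)"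
| "ren \<rho> (Ungel Q) = Ungel (ren (upr \<rho>) Q)"
| "ren \<rho> (Extent r M N0 N1 N) = Extent (ren \<rho> r) (ren \<rho> M)
     (ren (upr \<rho>) N0) (ren (upr \<rho>) N1) (ren (upr (upr (upr \<rho>))) N)"

abbreviation lift :: "tm \<Rightarrow> tm" where
  "lift \<equiv> ren Suc"

fun up :: "(nat \<Rightarrow> tm) \<Rightarrow> nat \<Rightarrow> tm" where
  "up \<sigma> 0 = Var 0"
| "up \<sigma> (Suc n) = lift (\<sigma> n)"

fun subst :: "(nat \<Rightarrow> tm) \<Rightarrow> tm \<Rightarrow> tm" where
  "subst \<sigma> (Var n) = \<sigma> n"
| "subst \<sigma> I0 = I0"
| "subst \<sigma> I1 = I1"
| "subst \<sigma> B0 = B0"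
| "subst \<sigma> B1 = B1"
| "subst \<sigma> Univ = Univ"
| "subst \<sigma> Void = Void"
| "subst \<sigma> (Abort M) = Abort (subst \<sigma> M)"
| "subst \<sigma> Unit = Unit"
| "subst \<sigma> Star = Star"
| "subst \<sigma> Bool = Bool"
| "subst \<sigma> TT = TT"
| "subst \<sigma> FF = FF"
| "subst \<sigma> (IfE C M T F) = IfE (subst (up \<sigma>) C) (subst \<sigma> M) (subst \<sigma> T) (subst \<sigma> F)"
| "subst \<sigma> (Pi A B) = Pi (subst \<sigma> A) (subst (up \<sigma>) B)"
| "subst \<sigma> (Lam M) = Lam (subst (up \<sigma>) M)"
| "subst \<sigma> (App M N) = App (subst \<sigma> M) (subst \<sigma> N)"
| "subst \<sigma> (Sig A B) = Sig (subst \<sigma> A) (subst (up \<sigma>) B)"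
| "subst \<sigma> (Tup M N) = Tup (subst \<sigma> M) (subst \<sigma> N)"
| "subst \<sigma> (Fst M) = Fst (subst \<sigma> M)"
| "subst \<sigma> (Snd M) = Snd (subst \<sigma> M)"
| "subst \<sigma> (Path A M N) = Path (subst (up \<sigma>) A) (subst \<sigma> M) (subst \<sigma> N)"
| "subst \<sigma> (PLam M) = PLam (subst (up \<sigma>) M)"
| "subst \<sigma> (PApp M r) = PApp (subst \<sigma> M) (subst \<sigma> r)"
| "subst \<sigma> (Coe A r s M) = Coe (subst (up \<sigma>) A) (subst \<sigma> r) (subst \<sigma> s) (subst \<sigma> M)"
| "subst \<sigma> (HCom A r s M T) = HCom (subst \<sigma> A) (subst \<sigma> r) (subst \<sigma> s) (subst \<sigma> M)
     (map (\<lambda>(a, b, N). (subst \<sigma> a, subst \<sigma> b, subst (up \<sigma>) N)) T)"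
| "subst \<sigma> (V r A B E) = V (subst \<sigma> r) (subst \<sigma> A) (subst \<sigma> B) (subst \<sigma> E)"
| "subst \<sigma> (VIn r M N) = VIn (subst \<sigma> r) (subst \<sigma> M) (subst \<sigma> N)"
| "subst \<sigma> (VProj r M E) = VProj (subst \<sigma> r) (subst \<sigma> M) (subst \<sigma> E)"
| "subst \<sigma> (Bridge A M N) = Bridge (subst (up \<sigma>) A) (subst \<sigma> M) (subst \<sigma> N)"
| "subst \<sigma> (BLam M) = BLam (subst (up \<sigma>) M)"
| "subst \<sigma> (BApp M r) = BApp (subst \<sigma> M) (subst \<sigma> r)"
| "subst \<sigma> (Gel r A B R) = Gel (subst \<sigma> r) (subst \<sigma> A) (subst \<sigma> B) (subst (up (up \<sigma>)) R)"
| "subst \<sigma> (GelI r M N P) = GelI (subst \<sigma> r) (subst \<sigma> M) (subst \<sigma> N) (subst \<sigma> P)"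
| "subst \<sigma> (Ungel Q) = Ungel (subst (up \<sigma>) Q)"
| "subst \<sigma> (Extent r M N0 N1 N) = Extent (subst \<sigma> r) (subst \<sigma> M)
     (subst (up \<sigma>) N0) (subst (up \<sigma>) N1) (subst (up (up (up \<sigma>))) N)"

fun scons :: "tm \<Rightarrow> (nat \<Rightarrow> tm) \<Rightarrow> nat \<Rightarrow> tm"  (infixr \<open>\<cdot>\<close> 65) where
  "(M \<cdot> \<sigma>) 0 = M"
| "(M \<cdot> \<sigma>) (Suc n) = \<sigma> n"

text \<open>
  In \<open>R\<langle>M, N\<rangle>\<close> the term \<open>N\<close> replaces the innermost variable and \<open>M\<close> the next one, matching
  the order in which a telescope \<open>a:A, b:B\<close> is written.
\<close>

abbreviation inst1 :: "tm \<Rightarrow> tm \<Rightarrow> tm"  (\<open>_\<langle>_\<rangle>\<close> [1000, 0] 1000) where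
  "M\<langle>N\<rangle> \<equiv> subst (N \<cdot> Var) M"

abbreviation inst2 :: "tm \<Rightarrow> tm \<Rightarrow> tm \<Rightarrow> tm"  (\<open>_\<langle>_,/ _\<rangle>\<close> [1000, 0, 0] 1000) where
  "R\<langle>M, N\<rangle> \<equiv> subst (N \<cdot> M \<cdot> Var) R"

definition arr :: "tm \<Rightarrow> tm \<Rightarrow> tm" where
  "arr A B = Pi A (lift B)"

definition neg :: "tm \<Rightarrow> tm" where
  "neg A = arr A Void"

definition isContr :: "tm \<Rightarrow> tm" where
  "isContr C = Sig C (Pi (lift C) (Path (lift (lift (lift C))) (Var 0) (Var 1)))"

text \<open>
  \<open>Equiv A B\<close> is \<open>\<Sigma> f : A \<rightarrow> B. \<Pi> b : B. isContr (\<Sigma> a : A. Path B (f a) b)\<close>.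
\<close>

definition Equiv :: "tm \<Rightarrow> tm \<Rightarrow> tm" where
  "Equiv A B = Sig (arr A B) (Pi (lift B)
     (isContr (Sig (lift (lift A))
        (Path (lift (lift (lift (lift B)))) (App (Var 2) (Var 0)) (Var 1)))))"


section \<open>Contexts\<close>

text \<open>
  The head of a context is its innermost entry.  A constraint \<open>Con r s\<close> assumes \<open>r = s\<close> and does
  not occupy a de Bruijn index.  \<open>Gone\<close> is a slot whose variable has become unavailable; it lets
  context restriction (\<open>hide\<close> below) keep all indices in place.
\<close>

datatype entry =
    Tm tm
  | PDim
  | BDim
  | Con tm tm
  | Gone

type_synonym ctx = "entry list"

fun lift_entry :: "entry \<Rightarrow> entry" where
  "lift_entry (Tm A) = Tm (lift A)"
| "lift_entry (Con r s) = Con (lift r) (lift s)"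
| "lift_entry PDim = PDim"
| "lift_entry BDim = BDim"
| "lift_entry Gone = Gone"

fun lookup :: "ctx \<Rightarrow> nat \<Rightarrow> entry option" where
  "lookup [] n = None"
| "lookup (Con r s # \<Gamma>) n = lookup \<Gamma> n"
| "lookup (e # \<Gamma>) 0 = Some (lift_entry e)"
| "lookup (e # \<Gamma>) (Suc n) = map_option lift_entry (lookup \<Gamma> n)"

fun constraints :: "ctx \<Rightarrow> (tm \<times> tm) set" where
  "constraints [] = {}"
| "constraints (Con r s # \<Gamma>) = insert (r, s) (constraints \<Gamma>)"
| "constraints (e # \<Gamma>) = map_prod lift lift ` constraints \<Gamma>"

text \<open>
  \<open>hide n \<Gamma>\<close> is the part of \<open>\<Gamma>\<close> apart from the bridge variable \<open>n\<close>.  It loses \<open>n\<close> itself, all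
  term variables introduced after \<open>n\<close> (their values may depend on \<open>n\<close>) and the constraints
  mentioning \<open>n\<close>; the other path and bridge dimension variables stay.
\<close>

fun hide :: "nat \<Rightarrow> ctx \<Rightarrow> ctx" where
  "hide n [] = []"
| "hide n (Con r s # \<Gamma>) = (if Var n \<in> {r, s} then hide n \<Gamma> else Con r s # hide n \<Gamma>)"
| "hide 0 (e # \<Gamma>) = Gone # \<Gamma>"
| "hide (Suc n) (Tm A # \<Gamma>) = Gone # hide n \<Gamma>"
| "hide (Suc n) (e # \<Gamma>) = e # hide n \<Gamma>"

fun apart :: "ctx \<Rightarrow> tm \<Rightarrow> ctx"  (infixl \<open>\<setminus>\<close> 70) where
  "\<Gamma> \<setminus> Var n = hide n \<Gamma>"
| "\<Gamma> \<setminus> r = \<Gamma>"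


section \<open>Dimensions\<close>

definition pdim :: "ctx \<Rightarrow> tm \<Rightarrow> bool" where
  "pdim \<Gamma> r \<longleftrightarrow> r = I0 \<or> r = I1 \<or> (\<exists>n. r = Var n \<and> lookup \<Gamma> n = Some PDim)"

definition bdim :: "ctx \<Rightarrow> tm \<Rightarrow> bool" where
  "bdim \<Gamma> r \<longleftrightarrow> r = B0 \<or> r = B1 \<or> (\<exists>n. r = Var n \<and> lookup \<Gamma> n = Some BDim)"

inductive deq :: "ctx \<Rightarrow> tm \<Rightarrow> tm \<Rightarrow> bool" for \<Gamma> where
  deq_assm: "(r, s) \<in> constraints \<Gamma> \<Longrightarrow> deq \<Gamma> r s"
| deq_refl: "deq \<Gamma> r r"
| deq_sym: "deq \<Gamma> r s \<Longrightarrow> deq \<Gamma> s r"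
| deq_trans: "deq \<Gamma> r s \<Longrightarrow> deq \<Gamma> s t \<Longrightarrow> deq \<Gamma> r t"

definition pdeq :: "ctx \<Rightarrow> tm \<Rightarrow> tm \<Rightarrow> bool" where
  "pdeq \<Gamma> r s \<longleftrightarrow> pdim \<Gamma> r \<and> pdim \<Gamma> s \<and> deq \<Gamma> r s"

definition bdeq :: "ctx \<Rightarrow> tm \<Rightarrow> tm \<Rightarrow> bool" where
  "bdeq \<Gamma> r s \<longleftrightarrow> bdim \<Gamma> r \<and> bdim \<Gamma> s \<and> deq \<Gamma> r s"

definition inconsistent :: "ctx \<Rightarrow> bool" where
  "inconsistent \<Gamma> \<longleftrightarrow> deq \<Gamma> I0 I1 \<or> deq \<Gamma> B0 B1"

text \<open>
  Bridge dimensions may only be constrained to be an endpoint: there are no diagonals.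
\<close>

definition constraint :: "ctx \<Rightarrow> tm \<Rightarrow> tm \<Rightarrow> bool" where
  "constraint \<Gamma> r s \<longleftrightarrow> pdim \<Gamma> r \<and> pdim \<Gamma> s \<or> bdim \<Gamma> r \<and> s \<in> {B0, B1}"

definition same_constraints :: "ctx \<Rightarrow> (tm \<times> tm \<times> tm) list \<Rightarrow> (tm \<times> tm \<times> tm) list \<Rightarrow> bool" where
  "same_constraints \<Gamma> T T' \<longleftrightarrow> list_all2 (\<lambda>(a, b, _) (a', b', _).
     constraint \<Gamma> a b \<and> constraint \<Gamma> a' b' \<and> deq \<Gamma> a a' \<and> deq \<Gamma> b b') T T'"


section \<open>Judgements\<close>

text \<open>
  \<open>\<Gamma> \<turnstile> A \<doteq> B type l\<close> is exact equality of (Kan) types and \<open>\<Gamma> \<turnstile> M \<doteq> N \<Colon> A\<close> exact equality of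
  elements.  Being a type or an element is the diagonal of these relations, so a congruence rule is
  at the same time the formation or introduction rule.  The universe \<open>Univ\<close> is Russell-style: the
  \<open>Small\<close> types are exactly its elements.  \<open>Univ\<close> itself and what is built from it is \<open>Large\<close>.
  Weakening, exchange and substitution (affine in the bridge variables) are not primitive rules;
  the context restriction \<open>\<Gamma> \<setminus> r\<close> is what excludes contraction of bridge variables.
\<close>

datatype level = Small | Large

inductive
      wf :: "ctx \<Rightarrow> bool"  (\<open>\<turnstile> _\<close> [50] 50)
  and tyeq :: "ctx \<Rightarrow> tm \<Rightarrow> tm \<Rightarrow> level \<Rightarrow> bool"
        (\<open>_ \<turnstile> _ \<doteq> _ type _\<close> [50, 60, 60, 60] 50)
  and tmeq :: "ctx \<Rightarrow> tm \<Rightarrow> tm \<Rightarrow> tm \<Rightarrow> bool"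
        (\<open>_ \<turnstile> _ \<doteq> _ \<Colon> _\<close> [50, 60, 60, 60] 50)
  and ty :: "ctx \<Rightarrow> tm \<Rightarrow> level \<Rightarrow> bool"  (\<open>_ \<turnstile> _ type _\<close> [50, 60, 60] 50)
  and tm :: "ctx \<Rightarrow> tm \<Rightarrow> tm \<Rightarrow> bool"  (\<open>_ \<turnstile> _ \<Colon> _\<close> [50, 60, 60] 50)
where
  "\<Gamma> \<turnstile> A type l \<equiv> \<Gamma> \<turnstile> A \<doteq> A type l"
| "\<Gamma> \<turnstile> M \<Colon> A \<equiv> \<Gamma> \<turnstile> M \<doteq> M \<Colon> A"

  \<comment> \<open>contexts\<close>
| wf_nil: "\<turnstile> []"
| wf_tm: "\<lbrakk>\<turnstile> \<Gamma>; \<Gamma> \<turnstile> A type l\<rbrakk> \<Longrightarrow> \<turnstile> Tm A # \<Gamma>"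
| wf_pdim: "\<turnstile> \<Gamma> \<Longrightarrow> \<turnstile> PDim # \<Gamma>"
| wf_bdim: "\<turnstile> \<Gamma> \<Longrightarrow> \<turnstile> BDim # \<Gamma>"
| wf_con: "\<lbrakk>\<turnstile> \<Gamma>; constraint \<Gamma> r s\<rbrakk> \<Longrightarrow> \<turnstile> Con r s # \<Gamma>"
| wf_gone: "\<turnstile> \<Gamma> \<Longrightarrow> \<turnstile> Gone # \<Gamma>"

  \<comment> \<open>structural rules\<close>
| ty_sym: "\<Gamma> \<turnstile> A \<doteq> B type l \<Longrightarrow> \<Gamma> \<turnstile> B \<doteq> A type l"
| ty_trans: "\<lbrakk>\<Gamma> \<turnstile> A \<doteq> B type l; \<Gamma> \<turnstile> B \<doteq> C type l\<rbrakk> \<Longrightarrow> \<Gamma> \<turnstile> A \<doteq> C type l"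
| tm_sym: "\<Gamma> \<turnstile> M \<doteq> N \<Colon> A \<Longrightarrow> \<Gamma> \<turnstile> N \<doteq> M \<Colon> A"
| tm_trans: "\<lbrakk>\<Gamma> \<turnstile> M \<doteq> N \<Colon> A; \<Gamma> \<turnstile> N \<doteq> P \<Colon> A\<rbrakk> \<Longrightarrow> \<Gamma> \<turnstile> M \<doteq> P \<Colon> A"
| tm_conv: "\<lbrakk>\<Gamma> \<turnstile> M \<doteq> N \<Colon> A; \<Gamma> \<turnstile> A \<doteq> B type l\<rbrakk> \<Longrightarrow> \<Gamma> \<turnstile> M \<doteq> N \<Colon> B"
| tm_var: "\<lbrakk>\<turnstile> \<Gamma>; lookup \<Gamma> n = Some (Tm A)\<rbrakk> \<Longrightarrow> \<Gamma> \<turnstile> Var n \<Colon> A"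
| ty_inconsistent:
    "\<lbrakk>inconsistent \<Gamma>; \<Gamma> \<turnstile> A type l; \<Gamma> \<turnstile> B type l\<rbrakk> \<Longrightarrow> \<Gamma> \<turnstile> A \<doteq> B type l"
| tm_inconsistent:
    "\<lbrakk>inconsistent \<Gamma>; \<Gamma> \<turnstile> M \<Colon> A; \<Gamma> \<turnstile> N \<Colon> A\<rbrakk> \<Longrightarrow> \<Gamma> \<turnstile> M \<doteq> N \<Colon> A"

  \<comment> \<open>the universe\<close>
| univ_ty: "\<turnstile> \<Gamma> \<Longrightarrow> \<Gamma> \<turnstile> Univ type Large"
| univ_intro: "\<Gamma> \<turnstile> A \<doteq> B type Small \<Longrightarrow> \<Gamma> \<turnstile> A \<doteq> B \<Colon> Univ"
| univ_elim: "\<Gamma> \<turnstile> A \<doteq> B \<Colon> Univ \<Longrightarrow> \<Gamma> \<turnstile> A \<doteq> B type Small"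
| ty_large: "\<Gamma> \<turnstile> A \<doteq> B type Small \<Longrightarrow> \<Gamma> \<turnstile> A \<doteq> B type Large"

  \<comment> \<open>the empty type, the unit type and booleans\<close>
| void_ty: "\<turnstile> \<Gamma> \<Longrightarrow> \<Gamma> \<turnstile> Void type Small"
| void_elim: "\<lbrakk>\<Gamma> \<turnstile> C type l; \<Gamma> \<turnstile> M \<doteq> M' \<Colon> Void\<rbrakk> \<Longrightarrow> \<Gamma> \<turnstile> Abort M \<doteq> Abort M' \<Colon> C"
| unit_ty: "\<turnstile> \<Gamma> \<Longrightarrow> \<Gamma> \<turnstile> Unit type Small"
| unit_intro: "\<turnstile> \<Gamma> \<Longrightarrow> \<Gamma> \<turnstile> Star \<Colon> Unit"
| unit_eta: "\<Gamma> \<turnstile> M \<Colon> Unit \<Longrightarrow> \<Gamma> \<turnstile> M \<doteq> Star \<Colon> Unit"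
| bool_ty: "\<turnstile> \<Gamma> \<Longrightarrow> \<Gamma> \<turnstile> Bool type Small"
| bool_true: "\<turnstile> \<Gamma> \<Longrightarrow> \<Gamma> \<turnstile> TT \<Colon> Bool"
| bool_false: "\<turnstile> \<Gamma> \<Longrightarrow> \<Gamma> \<turnstile> FF \<Colon> Bool"
| bool_elim:
    "\<lbrakk>Tm Bool # \<Gamma> \<turnstile> C \<doteq> C' type l; \<Gamma> \<turnstile> M \<doteq> M' \<Colon> Bool;
      \<Gamma> \<turnstile> T \<doteq> T' \<Colon> C\<langle>TT\<rangle>; \<Gamma> \<turnstile> F \<doteq> F' \<Colon> C\<langle>FF\<rangle>\<rbrakk>
     \<Longrightarrow> \<Gamma> \<turnstile> IfE C M T F \<doteq> IfE C' M' T' F' \<Colon> C\<langle>M\<rangle>"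
| bool_beta_true:
    "\<lbrakk>Tm Bool # \<Gamma> \<turnstile> C type l; \<Gamma> \<turnstile> T \<Colon> C\<langle>TT\<rangle>; \<Gamma> \<turnstile> F \<Colon> C\<langle>FF\<rangle>\<rbrakk>
     \<Longrightarrow> \<Gamma> \<turnstile> IfE C TT T F \<doteq> T \<Colon> C\<langle>TT\<rangle>"
| bool_beta_false:
    "\<lbrakk>Tm Bool # \<Gamma> \<turnstile> C type l; \<Gamma> \<turnstile> T \<Colon> C\<langle>TT\<rangle>; \<Gamma> \<turnstile> F \<Colon> C\<langle>FF\<rangle>\<rbrakk>
     \<Longrightarrow> \<Gamma> \<turnstile> IfE C FF T F \<doteq> F \<Colon> C\<langle>FF\<rangle>"
| bool_eta: "\<Gamma> \<turnstile> M \<Colon> Bool \<Longrightarrow> \<Gamma> \<turnstile> M \<doteq> IfE Bool M TT FF \<Colon> Bool"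

  \<comment> \<open>dependent functions\<close>
| pi_ty:
    "\<lbrakk>\<Gamma> \<turnstile> A \<doteq> A' type l; Tm A # \<Gamma> \<turnstile> B \<doteq> B' type l\<rbrakk> \<Longrightarrow> \<Gamma> \<turnstile> Pi A B \<doteq> Pi A' B' type l"
| pi_intro:
    "\<lbrakk>\<Gamma> \<turnstile> A type l; Tm A # \<Gamma> \<turnstile> M \<doteq> M' \<Colon> B\<rbrakk> \<Longrightarrow> \<Gamma> \<turnstile> Lam M \<doteq> Lam M' \<Colon> Pi A B"
| pi_elim:
    "\<lbrakk>\<Gamma> \<turnstile> M \<doteq> M' \<Colon> Pi A B; \<Gamma> \<turnstile> N \<doteq> N' \<Colon> A\<rbrakk> \<Longrightarrow> \<Gamma> \<turnstile> App M N \<doteq> App M' N' \<Colon> B\<langle>N\<rangle>"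
| pi_beta:
    "\<lbrakk>Tm A # \<Gamma> \<turnstile> M \<Colon> B; \<Gamma> \<turnstile> N \<Colon> A\<rbrakk> \<Longrightarrow> \<Gamma> \<turnstile> App (Lam M) N \<doteq> M\<langle>N\<rangle> \<Colon> B\<langle>N\<rangle>"
| pi_eta:
    "\<Gamma> \<turnstile> M \<Colon> Pi A B \<Longrightarrow> \<Gamma> \<turnstile> M \<doteq> Lam (App (lift M) (Var 0)) \<Colon> Pi A B"

  \<comment> \<open>dependent pairs\<close>
| sig_ty:
    "\<lbrakk>\<Gamma> \<turnstile> A \<doteq> A' type l; Tm A # \<Gamma> \<turnstile> B \<doteq> B' type l\<rbrakk> \<Longrightarrow> \<Gamma> \<turnstile> Sig A B \<doteq> Sig A' B' type l"
| sig_intro: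
    "\<lbrakk>Tm A # \<Gamma> \<turnstile> B type l; \<Gamma> \<turnstile> M \<doteq> M' \<Colon> A; \<Gamma> \<turnstile> N \<doteq> N' \<Colon> B\<langle>M\<rangle>\<rbrakk>
     \<Longrightarrow> \<Gamma> \<turnstile> Tup M N \<doteq> Tup M' N' \<Colon> Sig A B"
| sig_fst: "\<Gamma> \<turnstile> P \<doteq> P' \<Colon> Sig A B \<Longrightarrow> \<Gamma> \<turnstile> Fst P \<doteq> Fst P' \<Colon> A"
| sig_snd: "\<Gamma> \<turnstile> P \<doteq> P' \<Colon> Sig A B \<Longrightarrow> \<Gamma> \<turnstile> Snd P \<doteq> Snd P' \<Colon> B\<langle>Fst P\<rangle>"
| sig_beta_fst:
    "\<lbrakk>Tm A # \<Gamma> \<turnstile> B type l; \<Gamma> \<turnstile> M \<Colon> A; \<Gamma> \<turnstile> N \<Colon> B\<langle>M\<rangle>\<rbrakk> \<Longrightarrow> \<Gamma> \<turnstile> Fst (Tup M N) \<doteq> M \<Colon> A"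
| sig_beta_snd:
    "\<lbrakk>Tm A # \<Gamma> \<turnstile> B type l; \<Gamma> \<turnstile> M \<Colon> A; \<Gamma> \<turnstile> N \<Colon> B\<langle>M\<rangle>\<rbrakk> \<Longrightarrow> \<Gamma> \<turnstile> Snd (Tup M N) \<doteq> N \<Colon> B\<langle>M\<rangle>"
| sig_eta: "\<Gamma> \<turnstile> P \<Colon> Sig A B \<Longrightarrow> \<Gamma> \<turnstile> P \<doteq> Tup (Fst P) (Snd P) \<Colon> Sig A B"

  \<comment> \<open>path types\<close>
| path_ty:
    "\<lbrakk>PDim # \<Gamma> \<turnstile> A \<doteq> A' type l; \<Gamma> \<turnstile> M \<doteq> M' \<Colon> A\<langle>I0\<rangle>; \<Gamma> \<turnstile> N \<doteq> N' \<Colon> A\<langle>I1\<rangle>\<rbrakk>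
     \<Longrightarrow> \<Gamma> \<turnstile> Path A M N \<doteq> Path A' M' N' type l"
| path_intro:
    "PDim # \<Gamma> \<turnstile> M \<doteq> M' \<Colon> A \<Longrightarrow> \<Gamma> \<turnstile> PLam M \<doteq> PLam M' \<Colon> Path A M\<langle>I0\<rangle> M\<langle>I1\<rangle>"
| path_elim:
    "\<lbrakk>\<Gamma> \<turnstile> P \<doteq> P' \<Colon> Path A M N; pdeq \<Gamma> r r'\<rbrakk> \<Longrightarrow> \<Gamma> \<turnstile> PApp P r \<doteq> PApp P' r' \<Colon> A\<langle>r\<rangle>"
| path_0: "\<Gamma> \<turnstile> P \<Colon> Path A M N \<Longrightarrow> \<Gamma> \<turnstile> PApp P I0 \<doteq> M \<Colon> A\<langle>I0\<rangle>"
| path_1: "\<Gamma> \<turnstile> P \<Colon> Path A M N \<Longrightarrow> \<Gamma> \<turnstile> PApp P I1 \<doteq> N \<Colon> A\<langle>I1\<rangle>"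
| path_beta:
    "\<lbrakk>PDim # \<Gamma> \<turnstile> M \<Colon> A; pdim \<Gamma> r\<rbrakk> \<Longrightarrow> \<Gamma> \<turnstile> PApp (PLam M) r \<doteq> M\<langle>r\<rangle> \<Colon> A\<langle>r\<rangle>"
| path_eta:
    "\<Gamma> \<turnstile> P \<Colon> Path A M N \<Longrightarrow> \<Gamma> \<turnstile> P \<doteq> PLam (PApp (lift P) (Var 0)) \<Colon> Path A M N"

  \<comment> \<open>Kan operations: every type, including the universe, has coercion and homogeneous
     composition; they are characterised by typing and boundaries only, with no equations that
     unfold them at particular type formers\<close>
| coe:
    "\<lbrakk>PDim # \<Gamma> \<turnstile> A \<doteq> A' type l; pdeq \<Gamma> r r'; pdeq \<Gamma> s s'; \<Gamma> \<turnstile> M \<doteq> M' \<Colon> A\<langle>r\<rangle>\<rbrakk>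
     \<Longrightarrow> \<Gamma> \<turnstile> Coe A r s M \<doteq> Coe A' r' s' M' \<Colon> A\<langle>s\<rangle>"
| coe_refl:
    "\<lbrakk>PDim # \<Gamma> \<turnstile> A type l; pdim \<Gamma> r; \<Gamma> \<turnstile> M \<Colon> A\<langle>r\<rangle>\<rbrakk> \<Longrightarrow> \<Gamma> \<turnstile> Coe A r r M \<doteq> M \<Colon> A\<langle>r\<rangle>"
| hcom:
    "\<lbrakk>\<Gamma> \<turnstile> A \<doteq> A' type l; pdeq \<Gamma> r r'; pdeq \<Gamma> s s'; \<Gamma> \<turnstile> M \<doteq> M' \<Colon> A;
      same_constraints \<Gamma> T T';
      \<forall>a b N a' b' N'. (a, b, N) \<in> set T \<longrightarrow> (a', b', N') \<in> set T' \<longrightarrow>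
        PDim # Con a' b' # Con a b # \<Gamma> \<turnstile> N \<doteq> N' \<Colon> lift A;
      \<forall>a b N. (a, b, N) \<in> set T \<longrightarrow> Con a b # \<Gamma> \<turnstile> N\<langle>r\<rangle> \<doteq> M \<Colon> A\<rbrakk>
     \<Longrightarrow> \<Gamma> \<turnstile> HCom A r s M T \<doteq> HCom A' r' s' M' T' \<Colon> A"
| hcom_refl: "\<Gamma> \<turnstile> HCom A r r M T \<Colon> A \<Longrightarrow> \<Gamma> \<turnstile> HCom A r r M T \<doteq> M \<Colon> A"
| hcom_tube:
    "\<lbrakk>\<Gamma> \<turnstile> HCom A r s M T \<Colon> A; (a, b, N) \<in> set T; deq \<Gamma> a b\<rbrakk>
     \<Longrightarrow> \<Gamma> \<turnstile> HCom A r s M T \<doteq> N\<langle>s\<rangle> \<Colon> A"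

  \<comment> \<open>V-types: \<open>V r A B E\<close> turns an equivalence \<open>E\<close> between \<open>A\<close> and \<open>B\<close>, both of which may vary
     in \<open>r\<close>, into a line of types; together with coercion this makes the universe univalent\<close>
| v_ty:
    "\<lbrakk>pdeq \<Gamma> r r'; Con r I0 # \<Gamma> \<turnstile> A \<doteq> A' type l; \<Gamma> \<turnstile> B \<doteq> B' type l;
      Con r I0 # \<Gamma> \<turnstile> E \<doteq> E' \<Colon> Equiv A B\<rbrakk>
     \<Longrightarrow> \<Gamma> \<turnstile> V r A B E \<doteq> V r' A' B' E' type l"
| v_ty_0: "\<lbrakk>\<Gamma> \<turnstile> A type l; \<Gamma> \<turnstile> V I0 A B E type l\<rbrakk> \<Longrightarrow> \<Gamma> \<turnstile> V I0 A B E \<doteq> A type l"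
| v_ty_1: "\<lbrakk>\<Gamma> \<turnstile> B type l; \<Gamma> \<turnstile> V I1 A B E type l\<rbrakk> \<Longrightarrow> \<Gamma> \<turnstile> V I1 A B E \<doteq> B type l"
| v_intro:
    "\<lbrakk>pdeq \<Gamma> r r'; Con r I0 # \<Gamma> \<turnstile> A type l; \<Gamma> \<turnstile> B type l; Con r I0 # \<Gamma> \<turnstile> E \<Colon> Equiv A B;
      Con r I0 # \<Gamma> \<turnstile> M \<doteq> M' \<Colon> A; \<Gamma> \<turnstile> N \<doteq> N' \<Colon> B;
      Con r I0 # \<Gamma> \<turnstile> App (Fst E) M \<doteq> N \<Colon> B\<rbrakk>
     \<Longrightarrow> \<Gamma> \<turnstile> VIn r M N \<doteq> VIn r' M' N' \<Colon> V r A B E"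
| v_intro_0: "\<lbrakk>\<Gamma> \<turnstile> M \<Colon> A; \<Gamma> \<turnstile> VIn I0 M N \<Colon> A\<rbrakk> \<Longrightarrow> \<Gamma> \<turnstile> VIn I0 M N \<doteq> M \<Colon> A"
| v_intro_1: "\<lbrakk>\<Gamma> \<turnstile> N \<Colon> B; \<Gamma> \<turnstile> VIn I1 M N \<Colon> B\<rbrakk> \<Longrightarrow> \<Gamma> \<turnstile> VIn I1 M N \<doteq> N \<Colon> B"
| v_elim:
    "\<lbrakk>pdeq \<Gamma> r r'; Con r I0 # \<Gamma> \<turnstile> A type l; \<Gamma> \<turnstile> B type l; Con r I0 # \<Gamma> \<turnstile> E \<doteq> E' \<Colon> Equiv A B;
      \<Gamma> \<turnstile> M \<doteq> M' \<Colon> V r A B E\<rbrakk>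
     \<Longrightarrow> \<Gamma> \<turnstile> VProj r M E \<doteq> VProj r' M' E' \<Colon> B"
| v_elim_0:
    "\<lbrakk>\<Gamma> \<turnstile> M \<Colon> A; \<Gamma> \<turnstile> E \<Colon> Equiv A B\<rbrakk> \<Longrightarrow> \<Gamma> \<turnstile> VProj I0 M E \<doteq> App (Fst E) M \<Colon> B"
| v_elim_1:
    "\<lbrakk>\<Gamma> \<turnstile> M \<Colon> B; \<Gamma> \<turnstile> VProj I1 M E \<Colon> B\<rbrakk> \<Longrightarrow> \<Gamma> \<turnstile> VProj I1 M E \<doteq> M \<Colon> B"
| v_beta:
    "\<lbrakk>pdim \<Gamma> r; Con r I0 # \<Gamma> \<turnstile> A type l; \<Gamma> \<turnstile> B type l; Con r I0 # \<Gamma> \<turnstile> E \<Colon> Equiv A B;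
      Con r I0 # \<Gamma> \<turnstile> M \<Colon> A; \<Gamma> \<turnstile> N \<Colon> B; Con r I0 # \<Gamma> \<turnstile> App (Fst E) M \<doteq> N \<Colon> B\<rbrakk>
     \<Longrightarrow> \<Gamma> \<turnstile> VProj r (VIn r M N) E \<doteq> N \<Colon> B"
| v_eta:
    "\<lbrakk>pdim \<Gamma> r; Con r I0 # \<Gamma> \<turnstile> A type l; \<Gamma> \<turnstile> B type l; Con r I0 # \<Gamma> \<turnstile> E \<Colon> Equiv A B;
      \<Gamma> \<turnstile> M \<Colon> V r A B E\<rbrakk>
     \<Longrightarrow> \<Gamma> \<turnstile> M \<doteq> VIn r M (VProj r M E) \<Colon> V r A B E"

  \<comment> \<open>bridge types\<close>
| bridge_ty:
    "\<lbrakk>BDim # \<Gamma> \<turnstile> A \<doteq> A' type l; \<Gamma> \<turnstile> M \<doteq> M' \<Colon> A\<langle>B0\<rangle>; \<Gamma> \<turnstile> N \<doteq> N' \<Colon> A\<langle>B1\<rangle>\<rbrakk>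
     \<Longrightarrow> \<Gamma> \<turnstile> Bridge A M N \<doteq> Bridge A' M' N' type l"
| bridge_intro:
    "BDim # \<Gamma> \<turnstile> M \<doteq> M' \<Colon> A \<Longrightarrow> \<Gamma> \<turnstile> BLam M \<doteq> BLam M' \<Colon> Bridge A M\<langle>B0\<rangle> M\<langle>B1\<rangle>"
| bridge_elim:
    "\<lbrakk>\<turnstile> \<Gamma>; bdeq \<Gamma> r r'; \<Gamma> \<setminus> r \<turnstile> P \<doteq> P' \<Colon> Bridge A M N\<rbrakk>
     \<Longrightarrow> \<Gamma> \<turnstile> BApp P r \<doteq> BApp P' r' \<Colon> A\<langle>r\<rangle>"
| bridge_0: "\<Gamma> \<turnstile> P \<Colon> Bridge A M N \<Longrightarrow> \<Gamma> \<turnstile> BApp P B0 \<doteq> M \<Colon> A\<langle>B0\<rangle>"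
| bridge_1: "\<Gamma> \<turnstile> P \<Colon> Bridge A M N \<Longrightarrow> \<Gamma> \<turnstile> BApp P B1 \<doteq> N \<Colon> A\<langle>B1\<rangle>"
| bridge_beta:
    "\<lbrakk>\<turnstile> \<Gamma>; bdim \<Gamma> r; BDim # (\<Gamma> \<setminus> r) \<turnstile> M \<Colon> A\<rbrakk>
     \<Longrightarrow> \<Gamma> \<turnstile> BApp (BLam M) r \<doteq> M\<langle>r\<rangle> \<Colon> A\<langle>r\<rangle>"
| bridge_eta:
    "\<Gamma> \<turnstile> P \<Colon> Bridge A M N \<Longrightarrow> \<Gamma> \<turnstile> P \<doteq> BLam (BApp (lift P) (Var 0)) \<Colon> Bridge A M N"

  \<comment> \<open>Gel-types\<close>
| gel_ty:
    "\<lbrakk>\<turnstile> \<Gamma>; bdeq \<Gamma> r r'; \<Gamma> \<setminus> r \<turnstile> A \<doteq> A' type l; \<Gamma> \<setminus> r \<turnstile> B \<doteq> B' type l;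
      Tm (lift B) # Tm A # (\<Gamma> \<setminus> r) \<turnstile> R \<doteq> R' type l\<rbrakk>
     \<Longrightarrow> \<Gamma> \<turnstile> Gel r A B R \<doteq> Gel r' A' B' R' type l"
| gel_ty_0:
    "\<lbrakk>\<Gamma> \<turnstile> A type l; \<Gamma> \<turnstile> B type l; Tm (lift B) # Tm A # \<Gamma> \<turnstile> R type l\<rbrakk>
     \<Longrightarrow> \<Gamma> \<turnstile> Gel B0 A B R \<doteq> A type l"
| gel_ty_1:
    "\<lbrakk>\<Gamma> \<turnstile> A type l; \<Gamma> \<turnstile> B type l; Tm (lift B) # Tm A # \<Gamma> \<turnstile> R type l\<rbrakk>
     \<Longrightarrow> \<Gamma> \<turnstile> Gel B1 A B R \<doteq> B type l"
| gel_intro: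
    "\<lbrakk>\<turnstile> \<Gamma>; bdeq \<Gamma> r r'; \<Gamma> \<setminus> r \<turnstile> A type l; \<Gamma> \<setminus> r \<turnstile> B type l;
      Tm (lift B) # Tm A # (\<Gamma> \<setminus> r) \<turnstile> R type l;
      \<Gamma> \<setminus> r \<turnstile> M \<doteq> M' \<Colon> A; \<Gamma> \<setminus> r \<turnstile> N \<doteq> N' \<Colon> B; \<Gamma> \<setminus> r \<turnstile> P \<doteq> P' \<Colon> R\<langle>M, N\<rangle>\<rbrakk>
     \<Longrightarrow> \<Gamma> \<turnstile> GelI r M N P \<doteq> GelI r' M' N' P' \<Colon> Gel r A B R"
| gel_intro_0:
    "\<lbrakk>\<Gamma> \<turnstile> A type l; \<Gamma> \<turnstile> B type l; Tm (lift B) # Tm A # \<Gamma> \<turnstile> R type l;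
      \<Gamma> \<turnstile> M \<Colon> A; \<Gamma> \<turnstile> N \<Colon> B; \<Gamma> \<turnstile> P \<Colon> R\<langle>M, N\<rangle>\<rbrakk>
     \<Longrightarrow> \<Gamma> \<turnstile> GelI B0 M N P \<doteq> M \<Colon> A"
| gel_intro_1:
    "\<lbrakk>\<Gamma> \<turnstile> A type l; \<Gamma> \<turnstile> B type l; Tm (lift B) # Tm A # \<Gamma> \<turnstile> R type l;
      \<Gamma> \<turnstile> M \<Colon> A; \<Gamma> \<turnstile> N \<Colon> B; \<Gamma> \<turnstile> P \<Colon> R\<langle>M, N\<rangle>\<rbrakk>
     \<Longrightarrow> \<Gamma> \<turnstile> GelI B1 M N P \<doteq> N \<Colon> B"
| gel_elim:
    "\<lbrakk>\<Gamma> \<turnstile> A type l; \<Gamma> \<turnstile> B type l; Tm (lift B) # Tm A # \<Gamma> \<turnstile> R type l;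
      BDim # \<Gamma> \<turnstile> Q \<doteq> Q' \<Colon> Gel (Var 0) (lift A) (lift B) (ren (upr (upr Suc)) R)\<rbrakk>
     \<Longrightarrow> \<Gamma> \<turnstile> Ungel Q \<doteq> Ungel Q' \<Colon> R\<langle>Q\<langle>B0\<rangle>, Q\<langle>B1\<rangle>\<rangle>"
| gel_beta:
    "\<lbrakk>\<Gamma> \<turnstile> A type l; \<Gamma> \<turnstile> B type l; Tm (lift B) # Tm A # \<Gamma> \<turnstile> R type l;
      \<Gamma> \<turnstile> M \<Colon> A; \<Gamma> \<turnstile> N \<Colon> B; \<Gamma> \<turnstile> P \<Colon> R\<langle>M, N\<rangle>\<rbrakk>
     \<Longrightarrow> \<Gamma> \<turnstile> Ungel (GelI (Var 0) (lift M) (lift N) (lift P)) \<doteq> P \<Colon> R\<langle>M, N\<rangle>"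
| gel_eta:
    "\<lbrakk>\<turnstile> \<Gamma>; bdim \<Gamma> r; \<Gamma> \<setminus> r \<turnstile> A type l; \<Gamma> \<setminus> r \<turnstile> B type l;
      Tm (lift B) # Tm A # (\<Gamma> \<setminus> r) \<turnstile> R type l;
      BDim # (\<Gamma> \<setminus> r) \<turnstile> Q \<Colon> Gel (Var 0) (lift A) (lift B) (ren (upr (upr Suc)) R)\<rbrakk>
     \<Longrightarrow> \<Gamma> \<turnstile> Q\<langle>r\<rangle> \<doteq> GelI r Q\<langle>B0\<rangle> Q\<langle>B1\<rangle> (Ungel Q) \<Colon> Gel r A B R"

  \<comment> \<open>extent, for \<open>x. A\<close> and \<open>x. a:A. B\<close>: \<open>N0\<close>, \<open>N1\<close> bind \<open>a\<close> at the endpoints and \<open>N\<close> binds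
     \<open>a\<^sub>0\<close>, \<open>a\<^sub>1\<close> and a bridge \<open>c\<close> between them\<close>
| extent:
    "\<lbrakk>bdeq \<Gamma> r r'; BDim # (\<Gamma> \<setminus> r) \<turnstile> A type l; Tm A # BDim # (\<Gamma> \<setminus> r) \<turnstile> B type l;
      \<Gamma> \<turnstile> M \<doteq> M' \<Colon> A\<langle>r\<rangle>;
      Tm A\<langle>B0\<rangle> # (\<Gamma> \<setminus> r) \<turnstile> N0 \<doteq> N0' \<Colon> subst (up (B0 \<cdot> Var)) B;
      Tm A\<langle>B1\<rangle> # (\<Gamma> \<setminus> r) \<turnstile> N1 \<doteq> N1' \<Colon> subst (up (B1 \<cdot> Var)) B;
      Tm (Bridge (ren (upr (\<lambda>n. n + 2)) A) (Var 1) (Var 0)) #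
        Tm (lift A\<langle>B1\<rangle>) # Tm A\<langle>B0\<rangle> # (\<Gamma> \<setminus> r)
        \<turnstile> N \<doteq> N' \<Colon> Bridge (subst (BApp (Var 1) (Var 0) \<cdot> Var 0 \<cdot> (\<lambda>n. Var (n + 4))) B)
                       (subst (Var 2 \<cdot> (\<lambda>n. Var (n + 3))) N0)
                       (subst (Var 1 \<cdot> (\<lambda>n. Var (n + 3))) N1)\<rbrakk>
     \<Longrightarrow> \<Gamma> \<turnstile> Extent r M N0 N1 N \<doteq> Extent r' M' N0' N1' N' \<Colon> B\<langle>r, M\<rangle>"
| extent_0: "\<Gamma> \<turnstile> Extent B0 M N0 N1 N \<Colon> C \<Longrightarrow> \<Gamma> \<turnstile> Extent B0 M N0 N1 N \<doteq> N0\<langle>M\<rangle> \<Colon> C"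
| extent_1: "\<Gamma> \<turnstile> Extent B1 M N0 N1 N \<Colon> C \<Longrightarrow> \<Gamma> \<turnstile> Extent B1 M N0 N1 N \<doteq> N1\<langle>M\<rangle> \<Colon> C"
| extent_beta:
    "\<lbrakk>\<turnstile> \<Gamma>; bdim \<Gamma> r; BDim # (\<Gamma> \<setminus> r) \<turnstile> A type l; Tm A # BDim # (\<Gamma> \<setminus> r) \<turnstile> B type l;
      BDim # (\<Gamma> \<setminus> r) \<turnstile> M \<Colon> A;
      Tm A\<langle>B0\<rangle> # (\<Gamma> \<setminus> r) \<turnstile> N0 \<Colon> subst (up (B0 \<cdot> Var)) B;
      Tm A\<langle>B1\<rangle> # (\<Gamma> \<setminus> r) \<turnstile> N1 \<Colon> subst (up (B1 \<cdot> Var)) B;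
      Tm (Bridge (ren (upr (\<lambda>n. n + 2)) A) (Var 1) (Var 0)) #
        Tm (lift A\<langle>B1\<rangle>) # Tm A\<langle>B0\<rangle> # (\<Gamma> \<setminus> r)
        \<turnstile> N \<Colon> Bridge (subst (BApp (Var 1) (Var 0) \<cdot> Var 0 \<cdot> (\<lambda>n. Var (n + 4))) B)
                  (subst (Var 2 \<cdot> (\<lambda>n. Var (n + 3))) N0)
                  (subst (Var 1 \<cdot> (\<lambda>n. Var (n + 3))) N1)\<rbrakk>
     \<Longrightarrow> \<Gamma> \<turnstile> Extent r M\<langle>r\<rangle> N0 N1 N
           \<doteq> BApp (subst (BLam M \<cdot> M\<langle>B1\<rangle> \<cdot> M\<langle>B0\<rangle> \<cdot> Var) N) r \<Colon> B\<langle>r, M\<langle>r\<rangle>\<rangle>"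

definition WLEM :: tm where
  "WLEM = Pi Univ (Sig Bool (IfE Univ (Var 0) (neg (Var 1)) (neg (neg (Var 1)))))"

end

theory Submission
  imports Defs
begin

text \<open>
  Let \<open>w\<close> be a term of \<open>WLEM\<close> and write \<open>D b X\<close> for \<open>if (b; \<not>X; \<not>\<not>X)\<close>.  The booleans decided
  by \<open>w\<close> at the unit type and at the empty type are joined by a bridge, namely the values of \<open>w\<close> at
  the Gel-types of the empty relation between the two.  On the other hand, the relation
  \<open>R a b = (D a Unit \<rightarrow> D b Void \<rightarrow> Void)\<close> is reflexive on the booleans: the unit type is inhabited
  while the empty type is not, so neither \<open>true\<close> nor \<open>false\<close> is right for both.  Case distinction
  along a bridge of booleans into \<open>Gel x Bool Bool R\<close> shows, using the \<open>\<eta>\<close>-rule at the endpoints,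
  that its ends are related by \<open>R\<close>, so the evidence supplied by \<open>w\<close> at the unit and the empty type
  is contradictory.
\<close>

text \<open>Negations are written out as \<open>Pi _ Void\<close>, so that renaming and substitution
  act on the two arguments only and commute with it by simplification.\<close>

definition wlem_case :: "tm \<Rightarrow> tm \<Rightarrow> tm" where
  "wlem_case M X = IfE Univ M (Pi X Void) (Pi (Pi X Void) Void)"

lemma neg_eq: "neg X = Pi X Void"
  by (simp add: neg_def arr_def)

lemma WLEM_eq: "WLEM = Pi Univ (Sig Bool (wlem_case (Var 0) (Var (Suc 0))))"
  by (simp add: WLEM_def neg_eq wlem_case_def)

lemma subst_wlem_case [simp]:
  "subst \<sigma> (wlem_case M X) = wlem_case (subst \<sigma> M) (subst \<sigma> X)"
  by (simp add: wlem_case_def)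

lemma ren_wlem_case [simp]:
  "ren \<rho> (wlem_case M X) = wlem_case (ren \<rho> M) (ren \<rho> X)"
  by (simp add: wlem_case_def)

lemma neg_ty:
  assumes "\<turnstile> \<Gamma>" "\<Gamma> \<turnstile> X type Small"
  shows "\<Gamma> \<turnstile> Pi X Void type Small"
  using assms by (blast intro: pi_ty void_ty wf_tm)

lemma Univ_motive: "\<turnstile> \<Gamma> \<Longrightarrow> Tm Bool # \<Gamma> \<turnstile> Univ type Large"
  by (blast intro: univ_ty wf_tm bool_ty)

text \<open>The motive is the large type \<open>Univ\<close>, so the eliminator yields an equality
  of elements of the universe, which \<open>univ_elim\<close> reads as an equality of small types.
  Evidence can thus be moved between equal booleans.\<close>

lemma wlem_case_cong:
  assumes "\<turnstile> \<Gamma>" "\<Gamma> \<turnstile> X type Small" "\<Gamma> \<turnstile> M \<doteq> M' \<Colon> Bool"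
  shows "\<Gamma> \<turnstile> wlem_case M X \<doteq> wlem_case M' X type Small"
proof -
  have n: "\<Gamma> \<turnstile> Pi X Void \<Colon> Univ" "\<Gamma> \<turnstile> Pi (Pi X Void) Void \<Colon> Univ"
    by (auto intro!: univ_intro neg_ty assms)
  show ?thesis
    unfolding wlem_case_def
    by (rule univ_elim) (use bool_elim[OF Univ_motive[OF assms(1)] assms(3)] n in simp)
qed

lemma wlem_case_beta:
  assumes "\<turnstile> \<Gamma>" "\<Gamma> \<turnstile> X type Small"
  shows wlem_case_TT: "\<Gamma> \<turnstile> wlem_case TT X \<doteq> Pi X Void type Small"
    and wlem_case_FF: "\<Gamma> \<turnstile> wlem_case FF X \<doteq> Pi (Pi X Void) Void type Small"
proof -
  have n: "\<Gamma> \<turnstile> Pi X Void \<Colon> Univ" "\<Gamma> \<turnstile> Pi (Pi X Void) Void \<Colon> Univ"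
    by (auto intro!: univ_intro neg_ty assms)
  show "\<Gamma> \<turnstile> wlem_case TT X \<doteq> Pi X Void type Small"
    unfolding wlem_case_def
    by (rule univ_elim) (use bool_beta_true[OF Univ_motive[OF assms(1)]] n in simp)
  show "\<Gamma> \<turnstile> wlem_case FF X \<doteq> Pi (Pi X Void) Void type Small"
    unfolding wlem_case_def
    by (rule univ_elim) (use bool_beta_false[OF Univ_motive[OF assms(1)]] n in simp)
qed

lemma WLEM_ty:
  assumes "\<turnstile> \<Gamma>"
  shows "\<Gamma> \<turnstile> WLEM type Large"
proof -
  let ?\<Gamma> = "Tm Univ # \<Gamma>"
  have 1: "\<turnstile> ?\<Gamma>" using assms by (blast intro: wf_tm univ_ty)
  have 2: "\<turnstile> Tm Bool # ?\<Gamma>" using 1 by (blast intro: wf_tm bool_ty)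
  have "Tm Bool # ?\<Gamma> \<turnstile> Var (Suc 0) \<Colon> Univ" "Tm Bool # ?\<Gamma> \<turnstile> Var 0 \<Colon> Bool"
    by (rule tm_var[OF 2]; simp)+
  then have "Tm Bool # ?\<Gamma> \<turnstile> wlem_case (Var 0) (Var (Suc 0)) type Small"
    by (blast intro: wlem_case_cong 2 univ_elim)
  then have "?\<Gamma> \<turnstile> Sig Bool (wlem_case (Var 0) (Var (Suc 0))) type Large"
    by (intro sig_ty ty_large bool_ty 1)
  then show ?thesis
    unfolding WLEM_eq by (intro pi_ty univ_ty assms)
qed

text \<open>Used at an endpoint, where a Gel-type is exactly equal to \<open>Unit\<close> or
  \<open>Void\<close>: the values of \<open>w\<close> must agree there.\<close>

lemma WLEM_app:
  assumes "\<Gamma> \<turnstile> w \<Colon> WLEM" "\<Gamma> \<turnstile> X \<doteq> Y type Small"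
  shows "\<Gamma> \<turnstile> App w X \<doteq> App w Y \<Colon> Sig Bool (wlem_case (Var 0) (lift X))"
  using pi_elim[OF assms(1)[unfolded WLEM_eq] univ_intro[OF assms(2)]] by simp

text \<open>Open in two variables, \<open>a\<close> outer and \<open>b\<close> inner. The two
  occurrences of \<open>Var (Suc 0)\<close> differ: the first is \<open>a\<close>; the second stands
  under the binder of the first hypothesis and is \<open>b\<close>.\<close>

definition wlem_rel :: tm where
  "wlem_rel = Pi (wlem_case (Var (Suc 0)) Unit) (Pi (wlem_case (Var (Suc 0)) Void) Void)"

lemma wlem_rel_ty:
  assumes "\<turnstile> \<Gamma>"
  shows "Tm Bool # Tm Bool # \<Gamma> \<turnstile> wlem_rel type Small"
proof -
  let ?\<Gamma> = "Tm Bool # Tm Bool # \<Gamma>"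
  have 1: "\<turnstile> ?\<Gamma>" using assms by (blast intro: wf_tm bool_ty)
  have "?\<Gamma> \<turnstile> Var (Suc 0) \<Colon> Bool" by (rule tm_var[OF 1]) simp
  then have D: "?\<Gamma> \<turnstile> wlem_case (Var (Suc 0)) Unit type Small"
    by (blast intro: wlem_case_cong 1 unit_ty)
  let ?\<Delta> = "Tm (wlem_case (Var (Suc 0)) Unit) # ?\<Gamma>"
  have 2: "\<turnstile> ?\<Delta>" using 1 D by (rule wf_tm)
  have "?\<Delta> \<turnstile> Var (Suc 0) \<Colon> Bool" by (rule tm_var[OF 2]) simp
  then have "?\<Delta> \<turnstile> wlem_case (Var (Suc 0)) Void type Small"
    by (blast intro: wlem_case_cong 2 void_ty)
  then show ?thesis
    unfolding wlem_rel_def by (intro pi_ty D void_ty wf_tm[OF 2])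
qed

lemma wlem_rel_closed [simp]:
  "subst (up (up \<sigma>)) wlem_rel = wlem_rel"
  "ren (upr (upr \<rho>)) wlem_rel = wlem_rel"
  by (simp_all add: wlem_rel_def)

lemma wlem_rel_inst:
  "wlem_rel\<langle>M, N\<rangle> = Pi (wlem_case M Unit) (Pi (wlem_case (lift N) Void) Void)"
  by (simp add: wlem_rel_def)

definition wlem_rel_TT :: tm where
  "wlem_rel_TT = Lam (Lam (App (Var (Suc 0)) Star))"

definition wlem_rel_FF :: tm where
  "wlem_rel_FF = Lam (Lam (App (Var 0) (Lam (Var 0))))"

text \<open>At \<open>TT\<close> the first hypothesis is a map from \<open>Unit\<close> to
  \<open>Void\<close>, contradictory at \<open>Star\<close>. At \<open>FF\<close> the second is a
  double negation of \<open>Void\<close>, contradictory at the identity of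
  \<open>Void\<close>.\<close>

lemma wlem_rel_refl:
  assumes "\<turnstile> \<Gamma>"
  shows wlem_rel_TT: "\<Gamma> \<turnstile> wlem_rel_TT \<Colon> wlem_rel\<langle>TT, TT\<rangle>"
    and wlem_rel_FF: "\<Gamma> \<turnstile> wlem_rel_FF \<Colon> wlem_rel\<langle>FF, FF\<rangle>"
proof -
  \<comment> \<open>\<open>B\<close> stands for the constants \<open>TT\<close> and
    \<open>FF\<close>, which are booleans in every context, so it occurs unlifted under
    binders.\<close>
  have wf2: "\<turnstile> Tm (wlem_case B Void) # Tm (wlem_case B Unit) # \<Gamma>"
    and ty1: "\<Gamma> \<turnstile> wlem_case B Unit type Small"
    and ty2: "Tm (wlem_case B Unit) # \<Gamma> \<turnstile> wlem_case B Void type Small"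
    if "\<And>\<Delta>. \<turnstile> \<Delta> \<Longrightarrow> \<Delta> \<turnstile> B \<Colon> Bool" for B
    using that assms by (blast intro: wf_tm wlem_case_cong unit_ty void_ty)+
  show "\<Gamma> \<turnstile> wlem_rel_TT \<Colon> wlem_rel\<langle>TT, TT\<rangle>"
  proof -
    let ?\<Gamma> = "Tm (wlem_case TT Void) # Tm (wlem_case TT Unit) # \<Gamma>"
    have wf: "\<turnstile> ?\<Gamma>" by (rule wf2) (rule bool_true)
    have "?\<Gamma> \<turnstile> Var (Suc 0) \<Colon> wlem_case TT Unit" by (rule tm_var[OF wf]) simp
    then have "?\<Gamma> \<turnstile> Var (Suc 0) \<Colon> Pi Unit Void"
      using wf by (blast intro: tm_conv wlem_case_TT unit_ty)
    from pi_elim[OF this unit_intro[OF wf]]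
    have "?\<Gamma> \<turnstile> App (Var (Suc 0)) Star \<Colon> Void" by simp
    then show ?thesis
      unfolding wlem_rel_inst wlem_rel_TT_def
      by (auto intro!: pi_intro ty1 ty2 bool_true)
  qed
  show "\<Gamma> \<turnstile> wlem_rel_FF \<Colon> wlem_rel\<langle>FF, FF\<rangle>"
  proof -
    let ?\<Gamma> = "Tm (wlem_case FF Void) # Tm (wlem_case FF Unit) # \<Gamma>"
    have wf: "\<turnstile> ?\<Gamma>" by (rule wf2) (rule bool_false)
    have "?\<Gamma> \<turnstile> Var 0 \<Colon> wlem_case FF Void" by (rule tm_var[OF wf]) simp
    then have f: "?\<Gamma> \<turnstile> Var 0 \<Colon> Pi (Pi Void Void) Void"
      using wf by (blast intro: tm_conv wlem_case_FF void_ty)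
    have "\<turnstile> Tm Void # ?\<Gamma>" using wf by (blast intro: wf_tm void_ty)
    then have "Tm Void # ?\<Gamma> \<turnstile> Var 0 \<Colon> Void" by (rule tm_var) simp
    then have "?\<Gamma> \<turnstile> Lam (Var 0) \<Colon> Pi Void Void"
      using wf by (blast intro: pi_intro void_ty)
    from pi_elim[OF f this]
    have "?\<Gamma> \<turnstile> App (Var 0) (Lam (Var 0)) \<Colon> Void" by simp
    then show ?thesis
      unfolding wlem_rel_inst wlem_rel_FF_def
      by (auto intro!: pi_intro ty1 ty2 bool_false)
  qed
qed

abbreviation wlem_gel :: "tm \<Rightarrow> tm" where
  "wlem_gel r \<equiv> Gel r Bool Bool wlem_rel"

text \<open>\<open>b\<close> may depend on the dimension \<open>r\<close>, whereas the arguments of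
  \<open>GelI\<close> must be apart from it. Case distinction puts only closed terms into
  \<open>GelI\<close>.\<close>

definition wlem_line :: "tm \<Rightarrow> tm \<Rightarrow> tm" where
  "wlem_line r b = IfE (wlem_gel (lift r)) b
     (GelI r TT TT wlem_rel_TT) (GelI r FF FF wlem_rel_FF)"

lemma gelI_wlem_rel:
  assumes "\<turnstile> \<Gamma>" "\<turnstile> \<Gamma> \<setminus> r" "bdim \<Gamma> r"
  shows "\<Gamma> \<turnstile> GelI r TT TT wlem_rel_TT \<Colon> wlem_gel r"
    and "\<Gamma> \<turnstile> GelI r FF FF wlem_rel_FF \<Colon> wlem_gel r"
proof -
  have r: "bdeq \<Gamma> r r" using assms(3) by (simp add: bdeq_def deq_refl)
  have R: "Tm (lift Bool) # Tm Bool # \<Gamma> \<setminus> r \<turnstile> wlem_rel type Small"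
    using wlem_rel_ty[OF assms(2)] by simp
  note b = bool_ty[OF assms(2)] and i = gel_intro[OF assms(1) r]
  show "\<Gamma> \<turnstile> GelI r TT TT wlem_rel_TT \<Colon> wlem_gel r"
    by (intro i[OF b b R] bool_true wlem_rel_TT assms(2))
  show "\<Gamma> \<turnstile> GelI r FF FF wlem_rel_FF \<Colon> wlem_gel r"
    by (intro i[OF b b R] bool_false wlem_rel_FF assms(2))
qed

lemma wlem_line_tm:
  assumes "\<turnstile> \<Gamma>" "BDim # \<Gamma> \<turnstile> b \<Colon> Bool"
  shows "BDim # \<Gamma> \<turnstile> wlem_line (Var 0) b \<Colon> wlem_gel (Var 0)"
proof -
  have wf: "\<turnstile> BDim # \<Gamma>" "\<turnstile> (BDim # \<Gamma>) \<setminus> Var 0"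
    using assms(1) by (auto intro: wf_bdim wf_gone)
  \<comment> \<open>Under the boolean bound by the motive the dimension has index one. Hiding it
    discards that boolean as well, which is harmless since the Gel-type does not mention it.\<close>
  have wf': "\<turnstile> Tm Bool # BDim # \<Gamma>" "\<turnstile> (Tm Bool # BDim # \<Gamma>) \<setminus> Var (Suc 0)"
    using assms(1) by (auto intro: wf_bdim wf_gone wf_tm bool_ty)
  have bd: "bdim (BDim # \<Gamma>) (Var 0)" by (simp add: bdim_def)
  have r: "bdeq (Tm Bool # BDim # \<Gamma>) (Var (Suc 0)) (Var (Suc 0))"
    by (simp add: bdeq_def bdim_def deq_refl)
  have C: "Tm Bool # BDim # \<Gamma> \<turnstile> wlem_gel (Var (Suc 0)) type Small"
    by (rule gel_ty[OF wf'(1) r]) (use wlem_rel_ty[OF wf'(2)] bool_ty[OF wf'(2)] in simp_all)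
  show ?thesis
    using bool_elim[OF C assms(2)] gelI_wlem_rel[OF wf bd]
    by (simp add: wlem_line_def)
qed

text \<open>At an endpoint the line computes to \<open>if (b; true; false)\<close>, which is \<open>b\<close> by \<open>\<eta>\<close>.\<close>

lemma wlem_line_end:
  assumes "\<turnstile> \<Gamma>" "\<Gamma> \<turnstile> b \<doteq> b' \<Colon> Bool" "e = B0 \<or> e = B1"
  shows "\<Gamma> \<turnstile> wlem_line e b \<doteq> b' \<Colon> Bool"
proof -
  have R: "Tm (lift Bool) # Tm Bool # \<Delta> \<turnstile> wlem_rel type Small"
    if "\<turnstile> \<Delta>" for \<Delta> using wlem_rel_ty[OF that] by simp
  have G: "\<Delta> \<turnstile> wlem_gel e \<doteq> Bool type Small" if "\<turnstile> \<Delta>" for \<Delta>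
    using assms(3) gel_ty_0 gel_ty_1 bool_ty[OF that] R[OF that] by blast
  have wf: "\<turnstile> Tm Bool # \<Gamma>" using assms(1) by (blast intro: wf_tm bool_ty)
  have T: "\<Gamma> \<turnstile> GelI e TT TT wlem_rel_TT \<doteq> TT \<Colon> Bool"
    using assms(3) gel_intro_0 gel_intro_1 bool_ty[OF assms(1)] R[OF assms(1)]
      bool_true[OF assms(1)] wlem_rel_TT[OF assms(1)] by blast
  have F: "\<Gamma> \<turnstile> GelI e FF FF wlem_rel_FF \<doteq> FF \<Colon> Bool"
    using assms(3) gel_intro_0 gel_intro_1 bool_ty[OF assms(1)] R[OF assms(1)]
      bool_false[OF assms(1)] wlem_rel_FF[OF assms(1)] by blast
  note conv = tm_conv[OF _ ty_sym[OF G[OF assms(1)]]]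
  have [simp]: "lift e = e" "subst \<sigma> e = e" for \<sigma> using assms(3) by auto
  \<comment> \<open>\<open>b\<close> need not be a constant: congruence of the eliminator replaces
    the motive and both branches by their values at the endpoint.\<close>
  have "\<Gamma> \<turnstile> wlem_line e b \<doteq> IfE Bool b' TT FF \<Colon> wlem_gel e"
    using bool_elim[OF G[OF wf] assms(2)] conv[OF T] conv[OF F]
    by (simp add: wlem_line_def)
  then have "\<Gamma> \<turnstile> wlem_line e b \<doteq> IfE Bool b' TT FF \<Colon> Bool"
    by (rule tm_conv[OF _ G[OF assms(1)]])
  moreover have "\<Gamma> \<turnstile> b' \<Colon> Bool" by (rule tm_trans[OF tm_sym[OF assms(2)] assms(2)])
  ultimately show ?thesis by (blast intro: tm_trans tm_sym bool_eta)
qed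


theorem theorem11p8:
  shows "\<exists>M. [] \<turnstile> M \<Colon> arr WLEM Void"
proof -
  \<comment> \<open>\<open>?w\<close> and \<open>?w'\<close> are the same hypothesis; the bridge
    variable of \<open>?Q\<close> shifts its index by one.\<close>
  let ?\<Gamma> = "[Tm WLEM]" and ?w = "Var 0" and ?w' = "Var (Suc 0)"
  let ?G = "\<lambda>r. Gel r Unit Void Void"
  let ?Q = "wlem_line (Var 0) (Fst (App ?w' (?G (Var 0))))"
  have lift_WLEM: "lift WLEM = WLEM" by (simp add: WLEM_eq)
  have wf: "\<turnstile> ?\<Gamma>" by (rule wf_tm[OF wf_nil WLEM_ty[OF wf_nil]])
  have wfB: "\<turnstile> BDim # ?\<Gamma>" and wfG: "\<turnstile> Gone # ?\<Gamma>"
    using wf by (blast intro: wf_bdim wf_gone)+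
  have w: "?\<Gamma> \<turnstile> ?w \<Colon> WLEM" by (rule tm_var[OF wf]) (simp add: lift_WLEM)
  have w': "BDim # ?\<Gamma> \<turnstile> ?w' \<Colon> WLEM" by (rule tm_var[OF wfB]) (simp add: lift_WLEM)
  have R: "Tm (lift Void) # Tm Unit # \<Delta> \<turnstile> Void type Small" if "\<turnstile> \<Delta>" for \<Delta>
    using that by (auto intro!: void_ty wf_tm unit_ty)
  have r: "bdeq (BDim # ?\<Gamma>) (Var 0) (Var 0)" by (simp add: bdeq_def bdim_def deq_refl)
  have "BDim # ?\<Gamma> \<turnstile> ?G (Var 0) type Small"
    by (rule gel_ty[OF wfB r]) (use unit_ty[OF wfG] void_ty[OF wfG] R[OF wfG] in simp_all)
  from wlem_line_tm[OF wf sig_fst[OF WLEM_app[OF w' this]]]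
  have Q: "BDim # ?\<Gamma> \<turnstile> ?Q \<Colon> wlem_gel (Var 0)" .
  have "?\<Gamma> \<turnstile> Ungel ?Q \<Colon> wlem_rel\<langle>?Q\<langle>B0\<rangle>, ?Q\<langle>B1\<rangle>\<rangle>"
    by (rule gel_elim[OF bool_ty[OF wf] bool_ty[OF wf]])
      (use Q wlem_rel_ty[OF wf] in simp_all)
  then have U: "?\<Gamma> \<turnstile> Ungel ?Q \<Colon> Pi (wlem_case ?Q\<langle>B0\<rangle> Unit) (Pi (wlem_case (lift ?Q\<langle>B1\<rangle>) Void) Void)"
    by (simp add: wlem_rel_inst)
  have ends: "?Q\<langle>e\<rangle> = wlem_line e (Fst (App ?w (?G e)))" if "e = B0 \<or> e = B1" for e
    using that by (auto simp: wlem_line_def wlem_rel_TT_def wlem_rel_FF_def)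
  \<comment> \<open>The evidence at \<open>X\<close> is typed over the boolean
    \<open>Fst (App ?w X)\<close>. This boolean equals the end of \<open>?Q\<close>, because
    \<open>?w\<close> respects the equality of \<open>?G e\<close> and \<open>X\<close>, so the
    evidence can be retyped. Closedness of \<open>X\<close> absorbs lifts and substitutions.\<close>
  have snd: "?\<Gamma> \<turnstile> Snd (App ?w X) \<Colon> wlem_case ?Q\<langle>e\<rangle> X"
    if e: "e = B0 \<or> e = B1" and X: "?\<Gamma> \<turnstile> ?G e \<doteq> X type Small" "lift X = X" "\<And>\<sigma>. subst \<sigma> X = X" for e X
  proof -
    have X': "?\<Gamma> \<turnstile> X type Small" using X(1) ty_sym ty_trans by blast
    have "?\<Gamma> \<turnstile> Fst (App ?w (?G e)) \<doteq> Fst (App ?w X) \<Colon> Bool"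
      by (rule sig_fst[OF WLEM_app[OF w X(1)]])
    from tm_sym[OF wlem_line_end[OF wf this e]]
    have b: "?\<Gamma> \<turnstile> Fst (App ?w X) \<doteq> ?Q\<langle>e\<rangle> \<Colon> Bool"
      unfolding ends[OF e] .
    have "?\<Gamma> \<turnstile> Snd (App ?w X) \<Colon> wlem_case (Fst (App ?w X)) X"
      using sig_snd[OF WLEM_app[OF w X']] X by simp
    then show ?thesis
      by (rule tm_conv) (rule wlem_case_cong[OF wf X' b])
  qed
  have "?\<Gamma> \<turnstile> ?G B0 \<doteq> Unit type Small" "?\<Gamma> \<turnstile> ?G B1 \<doteq> Void type Small"
    by (intro gel_ty_0 gel_ty_1 R wf unit_ty void_ty)+
  from snd[OF _ this(1)] snd[OF _ this(2)]
  have s: "?\<Gamma> \<turnstile> Snd (App ?w Unit) \<Colon> wlem_case ?Q\<langle>B0\<rangle> Unit"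
    and t: "?\<Gamma> \<turnstile> Snd (App ?w Void) \<Colon> wlem_case ?Q\<langle>B1\<rangle> Void"
    by simp_all
  \<comment> \<open>Unfolding the line lets the lift on the second end cancel against the
    substitution of the first piece of evidence.\<close>
  have "?\<Gamma> \<turnstile> App (Ungel ?Q) (Snd (App ?w Unit)) \<Colon> Pi (wlem_case ?Q\<langle>B1\<rangle> Void) Void"
    using pi_elim[OF U s]
    by (simp add: wlem_line_def wlem_rel_TT_def wlem_rel_FF_def)
  from pi_intro[OF WLEM_ty[OF wf_nil] pi_elim[OF this t]]
  show ?thesis by (auto simp: arr_def)
qed

end
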